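(* Let $r\ge 1$ be an integer, $\lambda_r\in\mathbb{R}\setminus\{0,1\}$, and $k\ge r+1$. Let $\xi^{(k)}_1$ and $\xi^{(k)}_k$ be the smallest and the greatest zeros of $P_k$, and let ${\xi^d}^{(k)}_1,\dots,{\xi^d}^{(k)}_k$ denote the zeros of $P^d_k(\lambda_r;r)$. Then: \begin{enumerate} \item $\operatorname{sgn}\big[P^d_k(\lambda_r;r)(\xi^{(k)}_k)\big]=\operatorname{sgn}(1-\lambda_r)$. \item $\operatorname{sgn}\big[P^d_k(\lambda_r;r)(\xi^{(k)}_1)\big]=(-1)^k\operatorname{sgn}(1-\lambda_r)$. \item If $\lambda_r<1$, then: (a) $P^d_k(\lambda_r;r)(y)>0$ for all real $y\ge\xi^{(k)}_k$; (b) there are no real zeros of $P^d_k(\lambda_r;r)$ greater than $\xi^{(k)}_k$; (c) $(-1)^kP^d_k(\lambda_r;r)(x)>0$ for all real $x\le\xi^{(k)}_1$; (d) there are no real zeros of $P^d_k(\lambda_r;r)$ less than $\xi^{(k)}_1$; (e) all real zeros of $P^d_k(\lambda_r;r)$ are in the open interval $(\xi^{(k)}_1,\xi^{(k)}_k)$. \item If $\lambda_r>1$, then: (a) there exists $i$, $1\le i\le k$, such that ${\xi^d}^{(k)}_i>\xi^{(k)}_k$, with $P^d_k(\lambda_r;r)({\xi^d}^{(k)}_i)=0$ and $P^d_k(\lambda_r;r)(-{\xi^d}^{(k)}_i)=0$, where $-{\xi^d}^{(k)}_i<-\xi^{(k)}_k=\xi^{(k)}_1$; (b) the number of real zeros of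 $P^d_k(\lambda_r;r)$ less than $\xi^{(k)}_1$ and the number of those greater than $\xi^{(k)}_k$ are odd (and they are necessarily equal). \end{enumerate}
   Context: $\{P_n\}_{n\ge0}$ denotes the monic Chebyshev polynomials of the second kind: $P_0=1$, $P_1=x$, $P_{n+2}(x)=xP_{n+1}(x)-\frac14P_n(x)$ for $n\ge 0$; the zeros of $P_n$ are real and simple. For an integer $r\ge 1$ and $\lambda_r\in\mathbb{R}\setminus\{0,1\}$, the $r$th-perturbed sequence by dilatation $\{P^d_n(\lambda_r;r)\}_{n\ge 0}$ is the monic sequence with $P^d_0=1$, $P^d_1(x)=x$, $P^d_{n+2}(x)=xP^d_{n+1}(x)-\gamma_{n+1}P^d_n(x)$ for $n\ge 0$, where $\gamma_r=\lambda_r/4$ and $\gamma_{n+1}=1/4$ for $n\ge 0$, $n\ne r-1$. For $\lambda_r>0$ the zeros of $P^d_k(\lambda_r;r)$ are real and simple; for $\lambda_r<0$ some may be non-real. $\operatorname{sgn}$ is the sign function. *)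

theory Defs
  imports Complex_Main "HOL-Computational_Algebra.Polynomial"
begin

(* Monic Chebyshev polynomials of the second kind, U_n / 2^n. *)
fun cheb_P :: "nat \<Rightarrow> real poly" where
  "cheb_P 0 = 1"
| "cheb_P (Suc 0) = [:0, 1:]"
| "cheb_P (Suc (Suc n)) = [:0, 1:] * cheb_P (Suc n) - smult (1/4) (cheb_P n)"

(* The coefficients have indices n >= 1; the value at n = 0 is never used when r >= 1. *)
definition dil_gamma :: "real \<Rightarrow> nat \<Rightarrow> nat \<Rightarrow> real" where
  "dil_gamma lam r n = (if n = r then lam / 4 else 1 / 4)"

(* The r-th perturbation of cheb_P by dilatation: only the r-th recurrence
   coefficient 1/4 is multiplied, by lam. *)
fun dil_P :: "real \<Rightarrow> nat \<Rightarrow> nat \<Rightarrow> real poly" where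
  "dil_P lam r 0 = 1"
| "dil_P lam r (Suc 0) = [:0, 1:]"
| "dil_P lam r (Suc (Suc n)) =
     [:0, 1:] * dil_P lam r (Suc n) - smult (dil_gamma lam r (Suc n)) (dil_P lam r n)"

(* Since all zeros of cheb_P k are real, Min and Max over the real zeros are
   the smallest and the greatest zero (for k >= 1, when there is one). *)
definition cheb_min_zero :: "nat \<Rightarrow> real" where
  "cheb_min_zero k = Min {x. poly (cheb_P k) x = 0}"

definition cheb_max_zero :: "nat \<Rightarrow> real" where
  "cheb_max_zero k = Max {x. poly (cheb_P k) x = 0}"

(* z 1, ..., z k list the complex zeros of the monic polynomial dil_P lam r k,
   each repeated according to its multiplicity. *)
definition dil_zeros_enum :: "real \<Rightarrow> nat \<Rightarrow> nat \<Rightarrow> (nat \<Rightarrow> complex) \<Rightarrow> bool" where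
  "dil_zeros_enum lam r k z \<longleftrightarrow>
     map_poly complex_of_real (dil_P lam r k) = (\<Prod>i\<in>{1..k}. [:- z i, 1:])"

end

(* With r = a + 1 and k = a + b + 2, the perturbed polynomial splits at the modified coefficient as
   P^d_k = P_{a+1} P_{b+1} - (lam/4) P_a P_b, and lam = 1 gives
   P^d_k = P_k + (1 - lam)/4 * P_a P_b. The greatest zero of P_k is cos (pi/(k+1)), and P_a, P_b are
   positive from there on; this yields the signs and the case lam < 1. For lam > 1, a zero to the
   right of cos (pi/(k+1)) is a solution of q_{a+1} q_{b+1} = lam/4, where q_n = P_n / P_{n-1}.
   By q_{n+1} = x - 1/(4 q_n) these quotients are increasing there, so that there is exactly one such
   zero. The left end follows from the parity of the polynomials. *)
theory Submission
  imports Defs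
begin

section \<open>Splitting the perturbed polynomial at the modified coefficient\<close>

lemma dil_P_one: "dil_P 1 r n = cheb_P n"
  by (induction n rule: cheb_P.induct) (simp_all add: dil_gamma_def)

lemma dil_P_below: "n \<le> r \<Longrightarrow> dil_P lam r n = cheb_P n"
  by (induction n rule: cheb_P.induct) (simp_all add: dil_gamma_def)

text \<open>As functions of \<open>b\<close> both sides obey the unperturbed recurrence: the
  modified coefficient has index \<open>Suc a\<close> and enters only at \<open>b = 0\<close>, while
  all later steps use \<open>1/4\<close>.\<close>

lemma dil_P_split:
  "dil_P lam (Suc a) (Suc (Suc (a + b))) =
     cheb_P (Suc a) * cheb_P (Suc b) - smult (lam / 4) (cheb_P a * cheb_P b)"
proof (induction b rule: cheb_P.induct)
  case 1
  then show ?case by (simp add: dil_gamma_def dil_P_below)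
next
  case 2
  have "cheb_P (Suc a) * [:1 / 4:] = smult (1 / 4) (cheb_P (Suc a))"
    by simp
  then show ?case
    by (simp add: dil_gamma_def dil_P_below algebra_simps del: mult_pCons_left mult_pCons_right)
next
  case (3 n)
  have "dil_P lam (Suc a) (Suc (Suc (a + Suc (Suc n)))) =
      [:0, 1:] * dil_P lam (Suc a) (Suc (Suc (a + Suc n)))
        - smult (1/4) (dil_P lam (Suc a) (Suc (Suc (a + n))))"
    by (simp add: dil_gamma_def)
  then show ?case
    unfolding 3
    by (simp add: algebra_simps smult_diff_right smult_add_right
          del: mult_pCons_left mult_pCons_right)
qed

lemma dil_P_eq_cheb_P:
  "dil_P lam (Suc a) (Suc (Suc (a + b))) =
     cheb_P (Suc (Suc (a + b))) + smult ((1 - lam) / 4) (cheb_P a * cheb_P b)"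
proof -
  have "cheb_P (Suc (Suc (a + b))) =
      cheb_P (Suc a) * cheb_P (Suc b) - smult (1 / 4) (cheb_P a * cheb_P b)"
    using dil_P_split[of 1 a b] by (simp only: dil_P_one)
  then show ?thesis
    unfolding dil_P_split
    by (simp add: diff_divide_distrib smult_diff_left del: cheb_P.simps)
qed

section \<open>Parity and the sign of \<open>cheb_P\<close> to the right of its zeros\<close>

lemma poly_dil_P_minus: "poly (dil_P lam r n) (- x) = (-1) ^ n * poly (dil_P lam r n) x"
  by (induction n rule: cheb_P.induct) (simp_all add: algebra_simps)

lemma poly_cheb_P_minus: "poly (cheb_P n) (- x) = (-1) ^ n * poly (cheb_P n) x"
  \<comment> \<open>At \<open>lam = 1\<close> the position of the perturbation is immaterial, so
    \<open>0\<close> is an arbitrary choice.\<close>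
  using poly_dil_P_minus[of 1 0] by (simp add: dil_P_one)

text \<open>The classical sine formula for the second kind; \<open>2 ^ n\<close> undoes the monic
  normalisation. Keeping \<open>sin t\<close> as a factor avoids division where it vanishes.\<close>

lemma poly_cheb_P_cos: "2 ^ n * sin t * poly (cheb_P n) (cos t) = sin (real (Suc n) * t)"
proof (induction n rule: cheb_P.induct)
  case 2
  then show ?case by (simp add: sin_double)
next
  case (3 n)
  have "sin (real (Suc (Suc (Suc n))) * t) + sin (real (Suc n) * t) =
      2 * cos t * sin (real (Suc (Suc n)) * t)"
  proof -
    have "real (Suc (Suc (Suc n))) * t = real (Suc (Suc n)) * t + t"
      and "real (Suc n) * t = real (Suc (Suc n)) * t - t"
      by (simp_all add: algebra_simps)
    then show ?thesis by (simp add: sin_add sin_diff del: of_nat_Suc)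
  qed
  then show ?case
    using 3 by (simp add: algebra_simps del: of_nat_Suc)
qed simp

text \<open>Covers the range that the cosine substitution does not reach. The second conjunct
  strengthens the induction: a quotient of at least \<open>x - 1/2\<close>, hence at least 1/2,
  makes the subtracted reciprocal at most 1/2 in the next step. It also serves later as a growth
  bound.\<close>

lemma cheb_P_ge_one:
  assumes "x \<ge> 1"
  shows "poly (cheb_P n) x > 0 \<and> poly (cheb_P (Suc n)) x \<ge> (x - 1/2) * poly (cheb_P n) x"
proof (induction n)
  case (Suc n)
  let ?p = "poly (cheb_P n) x" and ?q = "poly (cheb_P (Suc n)) x"
  have "1/2 * ?p \<le> (x - 1/2) * ?p"
    using assms Suc by (intro mult_right_mono) auto
  with Suc have "?p \<le> 2 * ?q" and "?p > 0" by linarith+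
  then show ?case by (simp add: algebra_simps)
qed (use assms in simp)

text \<open>Below 1, put \<open>x = cos t\<close>. The hypothesis bounds \<open>t\<close> so that
  both \<open>t\<close> and \<open>real (Suc n) * t\<close> lie strictly between 0 and pi, and both
  sines in \<open>poly_cheb_P_cos\<close> are positive.\<close>

lemma cheb_P_pos:
  assumes "cos (pi / real (Suc n)) < x"
  shows "poly (cheb_P n) x > 0"
proof (cases "x \<ge> 1")
  case True
  then show ?thesis using cheb_P_ge_one by blast
next
  case False
  then have x: "-1 \<le> x" "x < 1"
    using assms cos_ge_minus_one[of "pi / real (Suc n)"] by linarith+
  define t where "t = arccos x"
  have cos_t: "cos t = x"
    using x by (simp add: t_def)
  then have "t \<noteq> 0"
    using x by auto
  then have t: "0 < t" "t \<le> pi"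
    using x arccos_lbound[of x] arccos_ubound[of x] by (auto simp: t_def less_le)
  have "pi / real (Suc n) \<le> pi"
    by (simp add: divide_le_eq)
  then have "t < pi / real (Suc n)"
    using assms cos_mono_less_eq[of "pi / real (Suc n)" t] t cos_t by simp
  then have "real (Suc n) * t < pi"
    by (simp add: less_divide_eq mult.commute del: of_nat_Suc)
  moreover have "t < pi"
    using \<open>t < pi / real (Suc n)\<close> \<open>pi / real (Suc n) \<le> pi\<close> by linarith
  ultimately have "sin t > 0" and "sin (real (Suc n) * t) > 0"
    using t by (auto intro!: sin_gt_zero simp del: of_nat_Suc)
  then show ?thesis
    using poly_cheb_P_cos[of n t] cos_t by (metis zero_less_mult_pos zero_less_mult_iff
      zero_less_power zero_less_numeral)
qed

section \<open>Location of the extreme zeros\<close>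

lemma cos_pi_div_less:
  assumes "m < n"
  shows "cos (pi / real (Suc m)) < cos (pi / real (Suc n))"
proof (rule cos_monotone_0_pi)
  show "pi / real (Suc n) < pi / real (Suc m)"
    using assms by (intro divide_strict_left_mono) auto
qed (auto simp: divide_le_eq)

lemma cheb_P_zero_cos:
  assumes "n \<ge> 1"
  shows "poly (cheb_P n) (cos (pi / real (Suc n))) = 0"
proof -
  \<comment> \<open>Here \<open>n \<ge> 1\<close> matters: at angle pi the sine would vanish and
    could not be cancelled.\<close>
  have "pi / real (Suc n) < pi"
    using assms by (simp add: divide_less_eq)
  then have "sin (pi / real (Suc n)) > 0"
    by (intro sin_gt_zero) auto
  then show ?thesis
    using poly_cheb_P_cos[of n "pi / real (Suc n)"] by simp
qed

lemma cheb_P_nonzero: "cheb_P n \<noteq> 0"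
  using cheb_P_ge_one[of 1 n] by auto

lemma cheb_max_zero_eq:
  assumes "n \<ge> 1"
  shows "cheb_max_zero n = cos (pi / real (Suc n))"
  unfolding cheb_max_zero_def
proof (rule Max_eqI)
  show "finite {x. poly (cheb_P n) x = 0}"
    by (rule poly_roots_finite[OF cheb_P_nonzero])
qed (use cheb_P_zero_cos[OF assms] cheb_P_pos[of n] in \<open>force simp: not_le[symmetric]\<close>)+

lemma cheb_min_zero_eq:
  assumes "n \<ge> 1"
  shows "cheb_min_zero n = - cheb_max_zero n"
  unfolding cheb_min_zero_def cheb_max_zero_eq[OF assms]
proof (rule Min_eqI)
  show "finite {x. poly (cheb_P n) x = 0}"
    by (rule poly_roots_finite[OF cheb_P_nonzero])
  show "- cos (pi / real (Suc n)) \<in> {x. poly (cheb_P n) x = 0}"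
    using cheb_P_zero_cos[OF assms] by (simp add: poly_cheb_P_minus)
  fix y assume "y \<in> {x. poly (cheb_P n) x = 0}"
  then have "poly (cheb_P n) (- y) = 0"
    by (simp add: poly_cheb_P_minus)
  then show "- cos (pi / real (Suc n)) \<le> y"
    using cheb_P_pos[of n "- y"] by force
qed

text \<open>Greatest zeros move strictly to the right as the degree grows, so positivity in lower
  degree includes the endpoint.\<close>

lemma cheb_P_pos_ge_max_zero:
  assumes "m < n" and "cheb_max_zero n \<le> x"
  shows "poly (cheb_P m) x > 0"
  using assms cos_pi_div_less[of m n] cheb_max_zero_eq[of n] by (intro cheb_P_pos) auto

lemma cheb_P_nonneg_ge_max_zero:
  assumes "n \<ge> 1" and "cheb_max_zero n \<le> x"
  shows "poly (cheb_P n) x \<ge> 0"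
  using assms cheb_P_pos[of n x] cheb_P_zero_cos[of n] cheb_max_zero_eq[of n]
  by (cases "cheb_max_zero n = x") auto

section \<open>Quotients of consecutive polynomials and the single outer zero for
  \<open>lam > 1\<close>\<close>

lemma cheb_P_quotient_strict_mono:
  assumes "cos (pi / real (Suc n)) < x" and "x < y"
  shows "poly (cheb_P (Suc n)) x / poly (cheb_P n) x < poly (cheb_P (Suc n)) y / poly (cheb_P n) y"
  using assms(1)
proof (induction n)
  case 0
  then show ?case using assms(2) by simp
next
  case (Suc n)
  define q where "q m z = poly (cheb_P (Suc m)) z / poly (cheb_P m) z" for m z
  have n: "cos (pi / real (Suc n)) < x"
    using Suc.prems cos_pi_div_less[of n "Suc n"] by linarith
  have pos: "poly (cheb_P n) z > 0" "poly (cheb_P (Suc n)) z > 0" if "x \<le> z" for z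
    using n Suc.prems that cheb_P_pos[of n z] cheb_P_pos[of "Suc n" z] by linarith+
  have rec: "q (Suc n) z = z - 1 / (4 * q n z)" if "x \<le> z" for z
    using pos[OF that] by (simp add: q_def field_simps)
  \<comment> \<open>The point \<open>x\<close> is beyond the greatest zero of the numerator of
    \<open>q n\<close>, so these values are positive and taking reciprocals reverses their
    order.\<close>
  have "0 < q n x" "q n x < q n y"
    using Suc.IH[OF n] pos[of x] by (simp_all add: q_def)
  then have "1 / (4 * q n y) < 1 / (4 * q n x)"
    by (intro divide_strict_left_mono) auto
  then have "q (Suc n) x < q (Suc n) y"
    using rec[of x] rec[of y] assms(2) by linarith
  then show ?case by (simp only: q_def)
qed

lemma dil_P_ex1_zero_gt_max_zero:
  fixes a b :: nat
  defines "k \<equiv> Suc (Suc (a + b))"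
  assumes "lam > 1"
  shows "\<exists>!x. poly (dil_P lam (Suc a) k) x = 0 \<and> x > cheb_max_zero k"
proof (rule ex_ex1I)
  let ?f = "poly (dil_P lam (Suc a) k)"
  let ?m = "cheb_max_zero k"
  have m: "?m = cos (pi / real (Suc k))"
    by (simp add: k_def cheb_max_zero_eq)
  \<comment> \<open>All four indices are below \<open>k\<close>, so \<open>?m\<close> itself is
    allowed.\<close>
  have pos: "poly (cheb_P j) x > 0" if "j \<in> {a, Suc a, b, Suc b}" "?m \<le> x" for j x
    using that by (intro cheb_P_pos_ge_max_zero[of j k]) (auto simp: k_def)
  show "\<exists>x. ?f x = 0 \<and> x > ?m"
  proof -
    have "poly (cheb_P k) ?m = 0"
      unfolding m by (rule cheb_P_zero_cos) (simp add: k_def)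
    moreover have "(1 - lam) * (poly (cheb_P a) ?m * poly (cheb_P b) ?m) < 0"
      using pos[of _ ?m] assms by (intro mult_neg_pos mult_pos_pos) auto
    ultimately have left: "?f ?m < 0"
      unfolding k_def dil_P_eq_cheb_P by (simp del: cheb_P.simps)
    \<comment> \<open>At this point each quotient is at least \<open>y - 1/2\<close>, which exceeds
      \<open>lam\<close>. The product of two quotients is then at least \<open>lam * lam\<close>,
      more than \<open>lam / 4\<close>, which makes \<open>?f y\<close> positive.\<close>
    define y where "y = 1 + lam"
    have y: "?m < y"
      using assms(2) m cos_le_one[of "pi / real (Suc k)"] unfolding y_def by linarith
    have q: "lam * poly (cheb_P j) y \<le> poly (cheb_P (Suc j)) y \<and> 0 < poly (cheb_P j) y" for j
    proof -
      have "lam * poly (cheb_P j) y \<le> (y - 1/2) * poly (cheb_P j) y"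
        using cheb_P_ge_one[of y j] assms by (intro mult_right_mono) (auto simp: y_def)
      then show ?thesis
        using cheb_P_ge_one[of y j] assms(2) unfolding y_def by linarith
    qed
    have "lam / 4 * (poly (cheb_P a) y * poly (cheb_P b) y)
        < (lam * lam) * (poly (cheb_P a) y * poly (cheb_P b) y)"
    proof (rule mult_strict_right_mono)
      have "lam * 1 < lam * lam"
        using assms by (intro mult_strict_left_mono) auto
      then show "lam / 4 < lam * lam"
        using assms by linarith
    qed (use q in simp)
    also have "\<dots> = (lam * poly (cheb_P a) y) * (lam * poly (cheb_P b) y)"
      by simp
    also have "\<dots> \<le> poly (cheb_P (Suc a)) y * poly (cheb_P (Suc b)) y"
      using q[of a] q[of b] q[of "Suc a"] assms by (intro mult_mono) auto
    finally have "?f y > 0"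
      unfolding k_def dil_P_split by (simp del: cheb_P.simps)
    then show ?thesis
      using poly_IVT_pos[OF y left] by blast
  qed
  define q where "q j x = poly (cheb_P (Suc j)) x / poly (cheb_P j) x" for j x
  have zero: "q a x * q b x = lam / 4" if "?f x = 0" "x > ?m" for x
    using that pos[of a x] pos[of b x] unfolding k_def dil_P_split
    by (simp add: q_def field_simps del: cheb_P.simps)
  have mono: "q a x * q b x < q a y * q b y" if "x > ?m" "x < y" for x y
  proof (rule mult_strict_mono)
    show "q a x < q a y" "q b x < q b y"
      using that cos_pi_div_less[of a k] cos_pi_div_less[of b k] m unfolding q_def
      by (intro cheb_P_quotient_strict_mono; simp add: k_def)+
    show "0 < q a y" "0 \<le> q b x"
      using that pos[of _ x] pos[of _ y]
      by (simp_all add: q_def less_imp_le del: cheb_P.simps)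
  qed
  fix x y
  assume "?f x = 0 \<and> x > ?m" "?f y = 0 \<and> y > ?m"
  then show "x = y"
    using zero[of x] zero[of y] mono[of x y] mono[of y x]
    by (cases x y rule: linorder_cases) auto
qed

section \<open>Real zeros in the complex enumeration, and assembly of the theorem\<close>

lemma poly_map_poly_of_real: "poly (map_poly of_real p) (of_real x) = of_real (poly p x)"
  by (induction p) (simp_all add: map_poly_pCons)

lemma dil_zeros_enum_zero:
  assumes "dil_zeros_enum lam r k z" and "poly (dil_P lam r k) t = 0"
  shows "\<exists>i\<in>{1..k}. z i = complex_of_real t"
proof -
  have "poly (map_poly complex_of_real (dil_P lam r k)) (complex_of_real t) =
      complex_of_real (poly (dil_P lam r k) t)"
    by (rule poly_map_poly_of_real)
  then have "(\<Prod>i\<in>{1..k}. complex_of_real t - z i) = 0"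
    using assms by (simp add: dil_zeros_enum_def poly_prod)
  then show ?thesis by auto
qed

theorem proposition5p7:
  fixes r k :: nat and lam :: real and xid :: "nat \<Rightarrow> complex"
  assumes "r \<ge> 1" and "lam \<noteq> 0" and "lam \<noteq> 1" and "k \<ge> r + 1"
    and "dil_zeros_enum lam r k xid"
  shows
    "sgn (poly (dil_P lam r k) (cheb_max_zero k)) = sgn (1 - lam)
     \<and> sgn (poly (dil_P lam r k) (cheb_min_zero k)) = (-1) ^ k * sgn (1 - lam)
     \<and> (lam < 1 \<longrightarrow>
          (\<forall>y::real. y \<ge> cheb_max_zero k \<longrightarrow> poly (dil_P lam r k) y > 0)
        \<and> \<not> (\<exists>y::real. poly (dil_P lam r k) y = 0 \<and> y > cheb_max_zero k)
        \<and> (\<forall>x::real. x \<le> cheb_min_zero k \<longrightarrow> (-1) ^ k * poly (dil_P lam r k) x > 0)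
        \<and> \<not> (\<exists>x::real. poly (dil_P lam r k) x = 0 \<and> x < cheb_min_zero k)
        \<and> (\<forall>x::real. poly (dil_P lam r k) x = 0 \<longrightarrow>
              x \<in> {cheb_min_zero k <..< cheb_max_zero k}))
     \<and> (lam > 1 \<longrightarrow>
          (\<exists>i\<in>{1..k}. \<exists>t::real. xid i = complex_of_real t \<and> t > cheb_max_zero k
             \<and> poly (dil_P lam r k) t = 0 \<and> poly (dil_P lam r k) (- t) = 0
             \<and> - t < - cheb_max_zero k \<and> - cheb_max_zero k = cheb_min_zero k)
        \<and> odd (card {x::real. poly (dil_P lam r k) x = 0 \<and> x < cheb_min_zero k})
        \<and> odd (card {x::real. poly (dil_P lam r k) x = 0 \<and> x > cheb_max_zero k})
        \<and> card {x::real. poly (dil_P lam r k) x = 0 \<and> x < cheb_min_zero k}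
            = card {x::real. poly (dil_P lam r k) x = 0 \<and> x > cheb_max_zero k})"
proof -
  obtain a where r: "r = Suc a"
    using assms(1) by (cases r) auto
  \<comment> \<open>The smallest degree \<open>k = r + 1\<close> corresponds to
    \<open>b = 0\<close>.\<close>
  obtain b where k: "k = Suc (Suc (a + b))"
    using assms(4) le_Suc_ex[of "Suc (Suc a)" k] r by auto
  let ?f = "poly (dil_P lam r k)"
  let ?m = "cheb_max_zero k"
  have k1: "k \<ge> 1" by (simp add: k)
  have min: "cheb_min_zero k = - ?m"
    by (rule cheb_min_zero_eq[OF k1])
  have f: "?f x = poly (cheb_P k) x + (1 - lam) / 4 * (poly (cheb_P a) x * poly (cheb_P b) x)" for x
    unfolding k r dil_P_eq_cheb_P by (simp del: cheb_P.simps)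
  have ab: "poly (cheb_P a) x * poly (cheb_P b) x > 0" if "?m \<le> x" for x
    using that cheb_P_pos_ge_max_zero[of _ k x] by (intro mult_pos_pos) (auto simp: k)
  have parity: "?f (- x) = (-1) ^ k * ?f x" for x
    by (rule poly_dil_P_minus)
  have sgn_max: "sgn (?f ?m) = sgn (1 - lam)"
  proof -
    have "poly (cheb_P k) ?m = 0"
      unfolding cheb_max_zero_eq[OF k1] by (rule cheb_P_zero_cos[OF k1])
    then have "sgn (?f ?m) = sgn ((1 - lam) / 4) * sgn (poly (cheb_P a) ?m * poly (cheb_P b) ?m)"
      by (simp only: f sgn_mult add_0)
    then show ?thesis
      using sgn_pos[OF ab[of ?m]] by (simp add: sgn_divide)
  qed
  have sgn_min: "sgn (?f (cheb_min_zero k)) = (-1) ^ k * sgn (1 - lam)"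
    using sgn_max by (simp add: min parity sgn_mult power_sgn[symmetric])
  have right: "?f x > 0" if "lam < 1" "x \<ge> ?m" for x
  proof -
    \<comment> \<open>Strictness comes from this term alone, as \<open>cheb_P k\<close> vanishes at
      \<open>?m\<close>.\<close>
    have "(1 - lam) / 4 * (poly (cheb_P a) x * poly (cheb_P b) x) > 0"
      using that ab[of x] by (intro mult_pos_pos[of "(1 - lam) / 4"]) auto
    then show ?thesis
      using cheb_P_nonneg_ge_max_zero[OF k1 that(2)] by (simp add: f)
  qed
  have left: "(-1) ^ k * ?f x > 0" if "lam < 1" "x \<le> cheb_min_zero k" for x
    using right[of "- x"] that by (simp add: min parity)
  have inside: "x \<in> {cheb_min_zero k <..< ?m}" if "lam < 1" "?f x = 0" for x
    using right[of x] left[of x] that by force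
  have zero_minus: "?f (- x) = 0 \<longleftrightarrow> ?f x = 0" for x
    by (simp add: parity)
  \<comment> \<open>Uniqueness gives exactly one zero on each side, which is sharper than an odd
    count.\<close>
  have outside:
    "(\<exists>i\<in>{1..k}. \<exists>t::real. xid i = complex_of_real t \<and> t > ?m \<and> ?f t = 0 \<and> ?f (- t) = 0
        \<and> - t < - ?m \<and> - ?m = cheb_min_zero k)
      \<and> card {x. ?f x = 0 \<and> x < cheb_min_zero k} = 1
      \<and> card {x. ?f x = 0 \<and> x > ?m} = 1" if lam: "lam > 1"
  proof -
    have "\<exists>!x. ?f x = 0 \<and> x > ?m"
      unfolding k r by (rule dil_P_ex1_zero_gt_max_zero[OF lam])
    then obtain t where t: "?f t = 0" "t > ?m" and uniq: "\<And>x. ?f x = 0 \<Longrightarrow> x > ?m \<Longrightarrow> x = t"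
      by auto
    have "{x. ?f x = 0 \<and> x > ?m} = {t}"
      using t uniq by blast
    \<comment> \<open>Negation exchanges the zeros beyond the two ends.\<close>
    moreover have "{x. ?f x = 0 \<and> x < cheb_min_zero k} = {- t}"
    proof -
      have "x = - t" if "?f x = 0" "x < - ?m" for x
      proof -
        have "- x = t"
          using that by (intro uniq) (simp_all add: zero_minus)
        then show ?thesis by simp
      qed
      moreover have "?f (- t) = 0" "- t < - ?m"
        using t by (simp_all add: zero_minus)
      ultimately show ?thesis
        unfolding min by blast
    qed
    moreover obtain i where "i \<in> {1..k}" "xid i = complex_of_real t"
      using dil_zeros_enum_zero[OF assms(5) t(1)] by blast
    ultimately show ?thesis
      using t zero_minus[of t] min by auto
  qed
  show ?thesis
  proof (intro conjI impI)
    assume "lam > 1"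
    note * = outside[OF this]
    from * show "\<exists>i\<in>{1..k}. \<exists>t::real. xid i = complex_of_real t \<and> t > ?m \<and> ?f t = 0
        \<and> ?f (- t) = 0 \<and> - t < - ?m \<and> - ?m = cheb_min_zero k"
      by blast
    from * show "odd (card {x. ?f x = 0 \<and> x < cheb_min_zero k})"
      "odd (card {x. ?f x = 0 \<and> x > ?m})"
      "card {x. ?f x = 0 \<and> x < cheb_min_zero k} = card {x. ?f x = 0 \<and> x > ?m}"
      by simp_all
  next
    assume lam: "lam < 1"
    show "\<forall>y. y \<ge> ?m \<longrightarrow> ?f y > 0"
      "\<forall>x. x \<le> cheb_min_zero k \<longrightarrow> (-1) ^ k * ?f x > 0"
      "\<forall>x. ?f x = 0 \<longrightarrow> x \<in> {cheb_min_zero k <..< ?m}"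
      using right[OF lam] left[OF lam] inside[OF lam] by blast+
    show "\<not> (\<exists>y. ?f y = 0 \<and> y > ?m)" "\<not> (\<exists>x. ?f x = 0 \<and> x < cheb_min_zero k)"
      using inside[OF lam] by (meson greaterThanLessThan_iff less_asym)+
  qed (fact sgn_max sgn_min)+
qed

end
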